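(* Let $F=g+h$ on $\mathbb{R}^n$, where $g:\mathbb{R}^n\to\mathbb{R}\cup\{+\infty\}$ is proper and lower semicontinuous (possibly nonconvex and nonsmooth) and $h:\mathbb{R}^n\to\mathbb{R}$ is twice continuously differentiable with $L$-Lipschitz continuous gradient, $L\ge 0$. Suppose that (a) for every $\mathbf{x}\in\mathbb{R}^n$ and every $\mathcal{S}\subseteq\operatorname{supp}(\mathbf{x})$, the restricted Hessian $\nabla^2_{\mathcal{S}}F$ is strictly continuous at $\mathbf{x}$ relative to $\{\mathbf{z}:\operatorname{supp}(\mathbf{z})=\operatorname{supp}(\mathbf{x})\}$; (b) $\inf F>-\infty$; (c) $F$ is coercive; (d) $F$ satisfies the Kurdyka--Łojasiewicz (KL) property at every point of $\operatorname{dom}(\partial F)$ with exponent $\theta\in(0,1)$. Let $\{\mathbf{x}^k\}_{k\ge0}$ and $\{\mathbf{y}^k\}_{k\ge0}$ be generated by the SCN-PG algorithm (described in the context), with $\mathbf{x}^0=\mathbf{y}^0$, $0<\alpha<1/L$, $\sigma_k\ge \frac{2(M(\mathbf{x}^k)+c)}{3}$, and with thresholds $$\varepsilon_k=\widehat C_3\bigl(\|\mathbf{x}^k-\mathbf{y}^{k-1}\|+\|\mathbf{x}^{k-1}-\mathbf{y}^{k-1}\|\bigr)^{\gamma},$$ where $\widehat C_3>0$ and $\gamma\in\bigl(0,\min(1,(1-\theta)/\theta)\bigr)$ (and $\varepsilon_k>0$ for all $k$, as the algorithm requires). Let $\overline{\mathbf{x}}$ be the limit of $\{\mathbf{x}^k\}$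 and $\overline{\mathcal S}=\operatorname{supp}(\overline{\mathbf{x}})$. Then $\mathcal S^k=\overline{\mathcal S}$ for all sufficiently large $k$.
   Context: Notation. $\operatorname{supp}(\mathbf{x})=\{i:x_i\ne0\}$. $\|\cdot\|$ is the Euclidean (or spectral) norm. $\partial$ is the limiting (Mordukhovich) subdifferential and $\operatorname{dom}(\partial F)=\{\mathbf x:\partial F(\mathbf x)\neq\emptyset\}$. For an index set $\mathcal S$, $\mathbf{x}_{\mathcal S}$ is the subvector indexed by $\mathcal S$, and $\nabla_{\mathcal S}F(\mathbf{x})$, $\nabla^2_{\mathcal S}F(\mathbf{x})$ are the gradient and Hessian of $F$ with respect to the variables indexed by $\mathcal S$ (the others being fixed). $\operatorname{Prox}_{\alpha g}(\mathbf{z})=\arg\min_{\mathbf{x}}\{g(\mathbf{x})+\frac1{2\alpha}\|\mathbf{x}-\mathbf{z}\|^2\}$. $1/L=+\infty$ if $L=0$. $F$ is coercive if $F(\mathbf{x})\to+\infty$ as $\|\mathbf{x}\|\to+\infty$. Strict continuity. A mapping $G$ is strictly continuous at $\overline{\mathbf{x}}$ relative to a set $X\ni\overline{\mathbf{x}}$ if $\operatorname{lip}_XG(\overline{\mathbf{x}}):=\limsup_{\mathbf{x},\mathbf{x}'\to\overline{\mathbf{x}},\ \mathbf{x}\neq\mathbf{x}'\in X}\frac{\|G(\mathbf{x}')-G(\mathbf{x})\|}{\|\mathbf{x}-\mathbf{x}'\|}$ is finite. Write $\operatorname{lip}\nabla^2_{\mathcal S}F(\mathbf{x})$ for the modulus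 relative to $X=\{\mathbf{z}:\operatorname{supp}(\mathbf{z})=\operatorname{supp}(\mathbf{x})\}$. KL property. $F$ has the KL property at $\widehat{\mathbf{x}}\in\operatorname{dom}\partial F$ if there are $\eta_0\in(0,+\infty]$, a neighborhood $U$ of $\widehat{\mathbf{x}}$ and a concave continuous $\phi:[0,\eta_0)\to[0,\infty)$ with $\phi(0)=0$, $\phi$ being $C^1$ on $(0,\eta_0)$ with $\phi'>0$ there, such that $\phi'(F(\mathbf{x})-F(\widehat{\mathbf{x}}))\operatorname{dist}(\mathbf{0},\partial F(\mathbf{x}))\ge1$ for all $\mathbf{x}\in U$ with $F(\widehat{\mathbf{x}})<F(\mathbf{x})<F(\widehat{\mathbf{x}})+\eta_0$. It holds with exponent $\theta$ if one can take $\phi(s)=\mu^{-1}s^{1-\theta}$ for some $\mu>0$ (equivalently, up to the constant, $\operatorname{dist}(\mathbf 0,\partial F(\mathbf x))\ge\mu(F(\mathbf x)-F(\widehat{\mathbf x}))^\theta$ for such $\mathbf{x}$). SCN-PG algorithm (run indefinitely). Inputs: $\mathbf{y}^0\in\mathbb{R}^n$, $0<\alpha<1/L$, $c>0$, $\eta>0$, $0<q<1$, $\omega_k\ge\underline\omega>1$, $\varepsilon_k>0$ (which may depend on the iterates computed so far, including $\mathbf{x}^k$). For $k=1,2,\dots$: (1) $\mathbf{x}^k\in\operatorname{Prox}_{\alpha g}(\mathbf{y}^{k-1}-\alpha\nabla h(\mathbf{y}^{k-1}))$. (2) $\mathcal S^k=\{i:|x^k_i|\ge\varepsilon_k\}$,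 $n_k=|\mathcal S^k|$. (3) If $\mathcal S^k=\emptyset$, set $\mathbf{y}^k=\mathbf{x}^k$. Otherwise let $\mathbf{g}^k=\nabla_{\mathcal S^k}F(\mathbf{x}^k)$, $H^k=\nabla^2_{\mathcal S^k}F(\mathbf{x}^k)$, choose $M(\mathbf{x}^k)\ge\omega_k\operatorname{lip}\nabla^2_{\mathcal S^k}F(\mathbf{x}^k)$ and $\sigma_k\ge\frac{2(M(\mathbf{x}^k)+c)}3$, and let $\mathbf{d}^k$ be a global minimizer over $\mathbb{R}^{n_k}$ of $\langle\mathbf{g}^k,\mathbf{d}\rangle+\frac12\langle(H^k+\eta I)\mathbf{d},\mathbf{d}\rangle+\frac{\sigma_k}6\|\mathbf{d}\|^3$. For $j=0,1,2,\dots$ let $\mathbf{y}^{k,j}$ be given by $\mathbf{y}^{k,j}_{\mathcal S^k}=\mathbf{x}^k_{\mathcal S^k}+q^j\mathbf{d}^k$, $\mathbf{y}^{k,j}_{(\mathcal S^k)^c}=\mathbf{x}^k_{(\mathcal S^k)^c}$; take the first $j$ with $F(\mathbf{y}^{k,j})\le F(\mathbf{x}^k)-\frac\eta4\|\mathbf{y}^{k,j}-\mathbf{x}^k\|^2-\frac c6\|\mathbf{y}^{k,j}-\mathbf{x}^k\|^3$ and set $\mathbf{y}^k=\mathbf{y}^{k,j}$, $\beta_k=q^j$. The condition on $\sigma_k$ concerns those $k$ with $\mathcal S^k\ne\emptyset$. Under the hypotheses (a)–(d) the sequence $\{\mathbf{x}^k\}$ converges. *)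

theory Defs
  imports "HOL-Analysis.Analysis"
begin

definition supp :: "real^'n \<Rightarrow> 'n set" where
  "supp x = {i. x $ i \<noteq> 0}"

definition proper_fun :: "('a \<Rightarrow> ereal) \<Rightarrow> bool" where
  "proper_fun f \<longleftrightarrow> (\<exists>x. f x \<noteq> \<infinity>) \<and> (\<forall>x. f x \<noteq> -\<infinity>)"

definition lsc :: "(real^'n \<Rightarrow> ereal) \<Rightarrow> bool" where
  "lsc f \<longleftrightarrow> (\<forall>x. f x \<le> Liminf (at x) f)"

definition coercive :: "(real^'n \<Rightarrow> ereal) \<Rightarrow> bool" where
  "coercive f \<longleftrightarrow> (f \<longlongrightarrow> \<infinity>) at_infinity"

definition Prox :: "real \<Rightarrow> (real^'n \<Rightarrow> ereal) \<Rightarrow> real^'n \<Rightarrow> (real^'n) set" where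
  "Prox \<alpha> g z = {x. \<forall>u. g x + ereal (1 / (2 * \<alpha>) * (norm (x - z))\<^sup>2)
                        \<le> g u + ereal (1 / (2 * \<alpha>) * (norm (u - z))\<^sup>2)}"

definition regular_subdiff :: "(real^'n \<Rightarrow> ereal) \<Rightarrow> real^'n \<Rightarrow> (real^'n) set" where
  "regular_subdiff F x = {v. \<bar>F x\<bar> \<noteq> \<infinity> \<and>
     0 \<le> Liminf (at x) (\<lambda>u. (F u - F x - ereal (v \<bullet> (u - x))) / ereal (norm (u - x)))}"

definition limiting_subdiff :: "(real^'n \<Rightarrow> ereal) \<Rightarrow> real^'n \<Rightarrow> (real^'n) set" where
  "limiting_subdiff F x = {v. \<bar>F x\<bar> \<noteq> \<infinity> \<and>
     (\<exists>X V. X \<longlonglongrightarrow> x \<and> (\<lambda>k. F (X k)) \<longlonglongrightarrow> F x \<and>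
            (\<forall>k. V k \<in> regular_subdiff F (X k)) \<and> V \<longlonglongrightarrow> v)}"

definition dom_subdiff :: "(real^'n \<Rightarrow> ereal) \<Rightarrow> (real^'n) set" where
  "dom_subdiff F = {x. limiting_subdiff F x \<noteq> {}}"

text \<open>Extended-real-valued, so that the distance to an empty subdifferential is \<open>\<infinity>\<close>
  (\<open>infdist\<close> would give \<open>0\<close>).\<close>
definition dist_subdiff :: "(real^'n \<Rightarrow> ereal) \<Rightarrow> real^'n \<Rightarrow> ereal" where
  "dist_subdiff F x = (INF v\<in>limiting_subdiff F x. ereal (dist 0 v))"

definition desingularizing :: "ereal \<Rightarrow> (real \<Rightarrow> real) \<Rightarrow> bool" where
  "desingularizing \<eta>0 \<phi> \<longleftrightarrow>
     (let I = {s. 0 \<le> s \<and> ereal s < \<eta>0}; J = {s. 0 < s \<and> ereal s < \<eta>0} in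
        \<phi> 0 = 0 \<and> (\<forall>s\<in>I. 0 \<le> \<phi> s) \<and> concave_on I \<phi> \<and> continuous_on I \<phi> \<and>
        (\<forall>s\<in>J. \<phi> differentiable (at s)) \<and> continuous_on J (deriv \<phi>) \<and> (\<forall>s\<in>J. 0 < deriv \<phi> s))"

definition KL_with :: "(real \<Rightarrow> real) \<Rightarrow> (real^'n \<Rightarrow> ereal) \<Rightarrow> real^'n \<Rightarrow> bool" where
  "KL_with \<phi> F xh \<longleftrightarrow>
     (\<exists>\<eta>0>0. \<exists>U. open U \<and> xh \<in> U \<and> desingularizing \<eta>0 \<phi> \<and>
        (\<forall>x\<in>U. F xh < F x \<and> F x < F xh + \<eta>0 \<longrightarrow>
           1 \<le> ereal (deriv \<phi> (real_of_ereal (F x - F xh))) * dist_subdiff F x))"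

definition KL_exponent :: "real \<Rightarrow> (real^'n \<Rightarrow> ereal) \<Rightarrow> real^'n \<Rightarrow> bool" where
  "KL_exponent \<theta> F xh \<longleftrightarrow> (\<exists>\<mu>>0. KL_with (\<lambda>s. inverse \<mu> * s powr (1 - \<theta>)) F xh)"

definition gradient :: "(real^'n \<Rightarrow> real) \<Rightarrow> real^'n \<Rightarrow> real^'n" where
  "gradient f x = (THE v. GDERIV f x :> v)"

definition hessian :: "(real^'n \<Rightarrow> real) \<Rightarrow> real^'n \<Rightarrow> real^'n^'n" where
  "hessian f x = jacobian (gradient f) (at x)"

definition twice_differentiable_at :: "(real^'n \<Rightarrow> real) \<Rightarrow> real^'n \<Rightarrow> bool" where
  "twice_differentiable_at f x \<longleftrightarrow>
     (\<forall>\<^sub>F u in nhds x. f differentiable (at u)) \<and> gradient f differentiable (at x)"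

definition C2 :: "(real^'n \<Rightarrow> real) \<Rightarrow> bool" where
  "C2 f \<longleftrightarrow> (\<forall>x. twice_differentiable_at f x) \<and> continuous_on UNIV (hessian f)"

definition replace_on :: "'n set \<Rightarrow> real^'n \<Rightarrow> real^'n \<Rightarrow> real^'n" where
  "replace_on S u x = (\<chi> i. if i \<in> S then u $ i else x $ i)"

text \<open>\<open>F\<close> as a function of the variables in \<open>S\<close>, the others being frozen at their values in
  \<open>x\<close>. As a function of \<open>u\<close> it does not depend on the coordinates outside \<open>S\<close>. Hence, although
  a vector of \<open>\<real>\<^sup>S\<close> is represented throughout by its extension by zero to all coordinates,
  \<open>grad_on\<close> and \<open>hess_on\<close> below are exactly the zero-padded gradient and Hessian in the
  variables \<open>S\<close>; padding changes neither inner products nor Euclidean and spectral norms.\<close>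
definition slice :: "(real^'n \<Rightarrow> ereal) \<Rightarrow> 'n set \<Rightarrow> real^'n \<Rightarrow> real^'n \<Rightarrow> real" where
  "slice F S x u = real_of_ereal (F (replace_on S u x))"

definition grad_on :: "(real^'n \<Rightarrow> ereal) \<Rightarrow> 'n set \<Rightarrow> real^'n \<Rightarrow> real^'n" where
  "grad_on F S x = gradient (slice F S x) x"

definition hess_on :: "(real^'n \<Rightarrow> ereal) \<Rightarrow> 'n set \<Rightarrow> real^'n \<Rightarrow> real^'n^'n" where
  "hess_on F S x = hessian (slice F S x) x"

text \<open>Since \<open>real_of_ereal\<close> sends infinite values to \<open>0\<close>, existence of the Hessian must include
  finiteness of \<open>F\<close> near \<open>x\<close> in the directions \<open>S\<close>. With no variables the (empty) Hessian always
  exists, whether or not \<open>F x\<close> is finite.\<close>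
definition hess_on_exists :: "(real^'n \<Rightarrow> ereal) \<Rightarrow> 'n set \<Rightarrow> real^'n \<Rightarrow> bool" where
  "hess_on_exists F S x \<longleftrightarrow> S = {} \<or>
     (\<forall>\<^sub>F u in nhds x. \<bar>F (replace_on S u x)\<bar> \<noteq> \<infinity>) \<and> twice_differentiable_at (slice F S x) x"

text \<open>The library norm on matrices is the Frobenius norm.\<close>
definition spectral_norm :: "real^'n^'m \<Rightarrow> real" where
  "spectral_norm A = onorm (\<lambda>v. A *v v)"

text \<open>If \<open>x\<close> is isolated in \<open>X\<close>, the filter is trivial and the value is \<open>-\<infinity>\<close> rather than \<open>0\<close>.
  For \<open>X = same_supp x\<close> this happens only if \<open>x = 0\<close>; strict continuity then holds, as it should,
  because it is expressed by \<open>< \<infinity>\<close>.\<close>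
definition lip_rel :: "(real^'n) set \<Rightarrow> (real^'n \<Rightarrow> real^'n^'n) \<Rightarrow> real^'n \<Rightarrow> ereal" where
  "lip_rel X G x = Limsup (at (x, x) within {(u, v). u \<in> X \<and> v \<in> X \<and> u \<noteq> v})
     (\<lambda>(u, v). ereal (spectral_norm (G v - G u) / norm (u - v)))"

definition same_supp :: "real^'n \<Rightarrow> (real^'n) set" where
  "same_supp x = {z. supp z = supp x}"

text \<open>The modulus involves \<open>hess_on F S z\<close> for all \<open>z\<close> in \<open>X\<close> near \<open>x\<close>, so the Hessian has to exist
  at all these points.\<close>
definition hess_strictly_continuous_rel ::
    "(real^'n) set \<Rightarrow> (real^'n \<Rightarrow> ereal) \<Rightarrow> 'n set \<Rightarrow> real^'n \<Rightarrow> bool" where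
  "hess_strictly_continuous_rel X F S x \<longleftrightarrow> x \<in> X \<and>
     (\<forall>\<^sub>F z in nhds x. z \<in> X \<longrightarrow> hess_on_exists F S z) \<and> lip_rel X (hess_on F S) x < \<infinity>"

definition lip_hess :: "(real^'n \<Rightarrow> ereal) \<Rightarrow> 'n set \<Rightarrow> real^'n \<Rightarrow> ereal" where
  "lip_hess F S x = lip_rel (same_supp x) (hess_on F S) x"

definition active :: "real \<Rightarrow> real^'n \<Rightarrow> 'n set" where
  "active \<epsilon> x = {i. \<epsilon> \<le> \<bar>x $ i\<bar>}"

definition cubic_model ::
    "(real^'n \<Rightarrow> ereal) \<Rightarrow> 'n set \<Rightarrow> real^'n \<Rightarrow> real \<Rightarrow> real \<Rightarrow> real^'n \<Rightarrow> real" where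
  "cubic_model F S x \<eta> \<sigma> d =
     grad_on F S x \<bullet> d + 1 / 2 * (((hess_on F S x + \<eta> *\<^sub>R mat 1) *v d) \<bullet> d) + \<sigma> / 6 * norm d ^ 3"

text \<open>\<open>{d. supp d \<subseteq> S}\<close> plays the role of \<open>\<real>\<^sup>S\<close>.\<close>
definition cubic_newton_direction ::
    "(real^'n \<Rightarrow> ereal) \<Rightarrow> 'n set \<Rightarrow> real^'n \<Rightarrow> real \<Rightarrow> real \<Rightarrow> real^'n \<Rightarrow> bool" where
  "cubic_newton_direction F S x \<eta> \<sigma> d \<longleftrightarrow> supp d \<subseteq> S \<and>
     (\<forall>e. supp e \<subseteq> S \<longrightarrow> cubic_model F S x \<eta> \<sigma> d \<le> cubic_model F S x \<eta> \<sigma> e)"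

definition sufficient_decrease ::
    "(real^'n \<Rightarrow> ereal) \<Rightarrow> real \<Rightarrow> real \<Rightarrow> real^'n \<Rightarrow> real^'n \<Rightarrow> bool" where
  "sufficient_decrease F c \<eta> x y \<longleftrightarrow>
     F y \<le> F x - ereal (\<eta> / 4 * (norm (y - x))\<^sup>2) - ereal (c / 6 * norm (y - x) ^ 3)"

definition linesearch_step ::
    "(real^'n \<Rightarrow> ereal) \<Rightarrow> real \<Rightarrow> real \<Rightarrow> real \<Rightarrow> real^'n \<Rightarrow> real^'n \<Rightarrow> real^'n \<Rightarrow> bool" where
  "linesearch_step F c \<eta> q x d y \<longleftrightarrow>
     (\<exists>j. y = x + q ^ j *\<^sub>R d \<and> sufficient_decrease F c \<eta> x y \<and>
          (\<forall>i<j. \<not> sufficient_decrease F c \<eta> x (x + q ^ i *\<^sub>R d)))"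

text \<open>\<open>M k\<close> is the number chosen as \<open>M(x\<^sup>k)\<close> in iteration \<open>k\<close>. The values at index \<open>0\<close> of
  \<open>\<epsilon>\<close>, \<open>\<omega>\<close>, \<open>M\<close>, \<open>\<sigma>\<close> are not used.\<close>
definition SCN_PG ::
    "(real^'n \<Rightarrow> ereal) \<Rightarrow> (real^'n \<Rightarrow> real) \<Rightarrow> real \<Rightarrow> real \<Rightarrow> real \<Rightarrow> real \<Rightarrow>
     (nat \<Rightarrow> real) \<Rightarrow> (nat \<Rightarrow> real) \<Rightarrow> (nat \<Rightarrow> real) \<Rightarrow> (nat \<Rightarrow> real) \<Rightarrow>
     (nat \<Rightarrow> real^'n) \<Rightarrow> (nat \<Rightarrow> real^'n) \<Rightarrow> bool" where
  "SCN_PG g h \<alpha> c \<eta> q \<omega> \<epsilon> M \<sigma> x y \<longleftrightarrow>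
     (let F = (\<lambda>z. g z + ereal (h z)) in
      \<forall>k\<ge>1. x k \<in> Prox \<alpha> g (y (k - 1) - \<alpha> *\<^sub>R gradient h (y (k - 1))) \<and>
        (let S = active (\<epsilon> k) (x k) in
          if S = {} then y k = x k
          else ereal (\<omega> k) * lip_hess F S (x k) \<le> ereal (M k) \<and>
               2 * (M k + c) / 3 \<le> \<sigma> k \<and>
               (\<exists>d. cubic_newton_direction F S (x k) \<eta> (\<sigma> k) d \<and>
                    linesearch_step F c \<eta> q (x k) d (y k))))"

end

theory Submission
  imports Defs
begin

text \<open>With \<open>r k = norm (x (Suc k) - y k) + norm (x k - y k)\<close>, the prox-gradient step and the
  line search give \<open>F (x (k + 2)) + a * (r (Suc k))\<^sup>2 \<le> F (x (Suc k))\<close>, and optimality in the prox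
  subproblem gives a subgradient of \<open>F\<close> at \<open>x (Suc k)\<close> of norm \<open>O(r k)\<close>. By the KL inequality
  the iterates converge at the rate \<open>norm (x (Suc k) - xbar) = O(r k + (r k) powr ((1 - \<theta>) / \<theta>))\<close>.
  Since \<open>\<gamma> < min 1 ((1 - \<theta>) / \<theta>)\<close>, this error is eventually smaller than the threshold
  \<open>\<epsilon> (Suc k) = C\<^sub>3 * (r k) powr \<gamma>\<close>, which itself tends to \<open>0\<close>; so the threshold separates the
  coordinates that vanish at \<open>xbar\<close> from the others. Second-order information plays no role: of
  the Newton step only the accepted sufficient decrease matters.\<close>

section \<open>Gradients and quadratic bounds for functions with Lipschitz gradient\<close>

text \<open>\<open>gradient\<close> is a definite description, so existence and uniqueness are both
  owed. Existence is Riesz representation in the standard basis; uniqueness is that of the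
  derivative.\<close>

lemma GDERIV_gradient:
  assumes "f differentiable (at x)"
  shows "GDERIV f x :> gradient f x"
proof -
  obtain D where D: "(f has_derivative D) (at x)"
    using assms by (auto simp: differentiable_def)
  interpret bounded_linear D
    using D by (rule has_derivative_bounded_linear)
  have D_eq: "D = (\<lambda>v. v \<bullet> (\<Sum>b\<in>Basis. D b *\<^sub>R b))"
  proof
    fix v
    have "D v = D (\<Sum>b\<in>Basis. (v \<bullet> b) *\<^sub>R b)"
      by (simp add: euclidean_representation)
    also have "\<dots> = (\<Sum>b\<in>Basis. (v \<bullet> b) * D b)"
      by (simp add: sum scaleR)
    finally show "D v = v \<bullet> (\<Sum>b\<in>Basis. D b *\<^sub>R b)"
      by (simp add: inner_sum_right mult.commute)
  qed
  have ex: "GDERIV f x :> (\<Sum>b\<in>Basis. D b *\<^sub>R b)"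
    unfolding gderiv_def using D by (subst (asm) D_eq)
  moreover have "w = (\<Sum>b\<in>Basis. D b *\<^sub>R b)" if "GDERIV f x :> w" for w
  proof -
    have "(\<lambda>v. v \<bullet> w) = (\<lambda>v. v \<bullet> (\<Sum>b\<in>Basis. D b *\<^sub>R b))"
      using that ex unfolding gderiv_def by (rule has_derivative_unique)
    then show ?thesis
      by (metis vector_eq_ldot)
  qed
  ultimately show ?thesis
    unfolding gradient_def by (rule theI)
qed

text \<open>Subtracting the linear and quadratic terms along the segment from \<open>x\<close> to
  \<open>u\<close> leaves a function \<open>\<psi>\<close> of one variable, whose derivative is
  nonpositive by Cauchy-Schwarz and the Lipschitz condition.\<close>

lemma lipschitz_gradient_upper_bound:
  fixes h :: "'a::real_inner \<Rightarrow> real"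
  assumes D: "\<And>x. GDERIV h x :> G x" and L: "L-lipschitz_on UNIV G"
  shows "h u - h x - G x \<bullet> (u - x) \<le> L / 2 * (norm (u - x))\<^sup>2"
proof -
  define d where "d = u - x"
  define \<psi> where "\<psi> t = h (x + t *\<^sub>R d) - t * (G x \<bullet> d) - L / 2 * t\<^sup>2 * (norm d)\<^sup>2" for t
  have "\<psi> 1 \<le> \<psi> 0"
  proof (rule DERIV_nonpos_imp_nonincreasing[where f = \<psi>])
    fix t :: real assume t: "0 \<le> t" "t \<le> 1"
    have "((\<lambda>t. h (x + t *\<^sub>R d)) has_derivative (\<lambda>s. (s *\<^sub>R d) \<bullet> G (x + t *\<^sub>R d))) (at t)"
      by (rule has_derivative_compose[OF _ D[unfolded gderiv_def]])
        (auto intro!: derivative_eq_intros)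
    then have "((\<lambda>t. h (x + t *\<^sub>R d)) has_real_derivative d \<bullet> G (x + t *\<^sub>R d)) (at t)"
      by (simp add: has_field_derivative_def mult_commute_abs)
    then have "(\<psi> has_real_derivative
        d \<bullet> G (x + t *\<^sub>R d) - G x \<bullet> d - L * t * (norm d)\<^sup>2) (at t)"
      unfolding \<psi>_def by (auto intro!: derivative_eq_intros)
    moreover have "d \<bullet> G (x + t *\<^sub>R d) - G x \<bullet> d \<le> L * t * (norm d)\<^sup>2"
    proof -
      have "d \<bullet> G (x + t *\<^sub>R d) - G x \<bullet> d = d \<bullet> (G (x + t *\<^sub>R d) - G x)"
        by (simp add: inner_diff_right inner_commute)
      also have "\<dots> \<le> norm d * norm (G (x + t *\<^sub>R d) - G x)"
        by (rule norm_cauchy_schwarz)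
      also have "\<dots> \<le> norm d * (L * (t * norm d))"
        using lipschitz_onD[OF L, of "x + t *\<^sub>R d" x] t
        by (intro mult_left_mono) (auto simp: dist_norm)
      finally show ?thesis
        by (simp add: power2_eq_square mult_ac)
    qed
    ultimately show "\<exists>y. (\<psi> has_real_derivative y) (at t) \<and> y \<le> 0"
      by (intro exI conjI) auto
  qed simp
  then show ?thesis
    by (simp add: \<psi>_def d_def)
qed

lemma lipschitz_gradient_lower_bound:
  fixes h :: "'a::real_inner \<Rightarrow> real"
  assumes D: "\<And>x. GDERIV h x :> G x" and L: "L-lipschitz_on UNIV G"
  shows "- (L / 2 * (norm (u - x))\<^sup>2) \<le> h u - h x - G x \<bullet> (u - x)"
proof -
  have "GDERIV (\<lambda>x. - h x) x :> - G x" for x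
    using D by (rule GDERIV_minus)
  moreover have "L-lipschitz_on UNIV (\<lambda>x. - G x)"
    using L by (rule lipschitz_on_minus)
  ultimately have "- h u - - h x - (- G x) \<bullet> (u - x) \<le> L / 2 * (norm (u - x))\<^sup>2"
    by (rule lipschitz_gradient_upper_bound)
  then show ?thesis
    by simp
qed

section \<open>Convergence and rate of abstract descent sequences under a KL inequality\<close>

text \<open>By concavity, the graph of \<open>\<lambda>s. s powr (1 - \<theta>)\<close> lies below
  its tangent at \<open>t\<close>. This converts a decrease of function values into a decrease of
  their desingularized values.\<close>

lemma powr_tangent_bound:
  fixes s t \<theta> :: real
  assumes st: "0 < s" "s \<le> t" and \<theta>: "0 < \<theta>" "\<theta> < 1"
  shows "(1 - \<theta>) * t powr - \<theta> * (t - s) \<le> t powr (1 - \<theta>) - s powr (1 - \<theta>)"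
proof (cases "s = t")
  case False
  have "\<exists>z. s < z \<and> z < t \<and>
      t powr (1 - \<theta>) - s powr (1 - \<theta>) = (t - s) * ((1 - \<theta>) * z powr - \<theta>)"
    using False st by (intro MVT2) (auto intro!: derivative_eq_intros)
  then obtain z where z: "s < z" "z < t"
    and eq: "t powr (1 - \<theta>) - s powr (1 - \<theta>) = (t - s) * ((1 - \<theta>) * z powr - \<theta>)"
    by blast
  have "t powr - \<theta> \<le> z powr - \<theta>"
    using z st \<theta> by (intro powr_mono2') auto
  then have "(t - s) * ((1 - \<theta>) * t powr - \<theta>) \<le> (t - s) * ((1 - \<theta>) * z powr - \<theta>)"
    using st \<theta> by (intro mult_left_mono) auto
  then show ?thesis
    unfolding eq by (simp add: mult_ac)
qed simp

text \<open>The squared step is at most the gap between consecutive values of \<open>f\<close>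
  divided by \<open>a\<close>, and the gaps vanish because \<open>f\<close> converges.\<close>

lemma descent_imp_steps_tendsto_0:
  fixes f r :: "nat \<Rightarrow> real"
  assumes a: "0 < a" and descent: "\<And>k. f (Suc k) + a * (r (Suc k))\<^sup>2 \<le> f k"
    and f_lim: "f \<longlonglongrightarrow> l"
  shows "r \<longlonglongrightarrow> 0"
proof -
  have "(\<lambda>k. (f k - f (Suc k)) / a) \<longlonglongrightarrow> (l - l) / a"
    by (intro tendsto_intros f_lim LIMSEQ_Suc) (use a in auto)
  then have "(\<lambda>k. sqrt ((f k - f (Suc k)) / a)) \<longlonglongrightarrow> 0"
    using tendsto_real_sqrt by fastforce
  moreover have "norm (r (Suc k)) \<le> sqrt ((f k - f (Suc k)) / a)" for k
    using descent[of k] a by (auto intro!: real_le_rsqrt simp: pos_le_divide_eq algebra_simps)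
  ultimately have "(\<lambda>k. r (Suc k)) \<longlonglongrightarrow> 0"
    by (rule Lim_null_comparison[OF eventuallyI, rotated])
  then show ?thesis
    by (rule LIMSEQ_imp_Suc)
qed

text \<open>\<open>V k = r k + A * (f k - fbar) powr (1 - \<theta>)\<close> is a Lyapunov function: near \<open>xbar\<close> its decrease
  dominates the length of the step, so the sequence is trapped near \<open>xbar\<close>, and the remaining
  path from \<open>x k\<close> on is no longer than \<open>V k\<close>.\<close>
lemma KL_descent_convergence:
  fixes x :: "nat \<Rightarrow> 'a::real_normed_vector" and r f :: "nat \<Rightarrow> real"
  assumes \<theta>: "0 < \<theta>" "\<theta> < 1" and a: "0 < a" and B: "0 < B"
    and r_pos: "\<And>k. 0 < r k"
    and descent: "\<And>k. f (Suc k) + a * (r (Suc k))\<^sup>2 \<le> f k"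
    and step: "\<And>k. norm (x (Suc k) - x k) \<le> r (Suc k)"
    and f_lim: "f \<longlonglongrightarrow> fbar"
    and sub: "strict_mono s" "(x \<circ> s) \<longlonglongrightarrow> xbar"
    and nbhd: "0 < \<delta>" "0 < \<rho>"
    and KL: "\<And>k. norm (x k - xbar) < \<delta> \<Longrightarrow> fbar < f k \<Longrightarrow> f k < fbar + \<rho> \<Longrightarrow>
          (f k - fbar) powr \<theta> \<le> B * r k"
  obtains A where "x \<longlonglongrightarrow> xbar" "r \<longlonglongrightarrow> 0"
    "\<forall>\<^sub>F k in sequentially. norm (x k - xbar) \<le> r k + A * (r k) powr ((1 - \<theta>) / \<theta>)"
proof -
  have f_dec: "f (Suc k) < f k" for k
    using descent[of k] a r_pos[of "Suc k"] by (smt (verit) mult_pos_pos zero_less_power)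
  then have "decseq f"
    by (intro decseq_SucI) (simp add: less_imp_le)
  then have "fbar \<le> f k" for k
    using f_lim by (rule decseq_ge)
  then have f_gt: "fbar < f k" for k
    using f_dec[of k] by (meson le_less_trans)
  have f_mono: "f k \<le> f m" if "m \<le> k" for m k
    using \<open>decseq f\<close> that by (rule decseqD)

  have r_lim: "r \<longlonglongrightarrow> 0"
    using a descent f_lim by (rule descent_imp_steps_tendsto_0)

  define E where "E k = (f k - fbar) powr (1 - \<theta>)" for k
  \<comment> \<open>Collects the KL constant \<open>B\<close>, the descent constant \<open>a\<close>
    and the factor \<open>1 - \<theta>\<close> of the tangent bound, so that \<open>A\<close> is the
    only constant left in \<open>V_step\<close>.\<close>
  define A where "A = B / ((1 - \<theta>) * a)"
  define V where "V k = r k + A * E k" for k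
  have A: "0 < A"
    using a B \<theta> by (simp add: A_def)
  have E_nonneg: "0 \<le> E k" for k
    by (simp add: E_def)
  have V_nonneg: "0 \<le> V k" for k
    using A E_nonneg[of k] r_pos[of k] by (simp add: V_def)
  have "E \<longlonglongrightarrow> 0"
    unfolding E_def
    by (intro tendsto_zero_powrI[where b = "1 - \<theta>"])
      (use \<theta> f_gt f_lim in \<open>auto intro!: tendsto_eq_intros eventuallyI simp: less_imp_le\<close>)
  then have V_lim: "V \<longlonglongrightarrow> 0"
    unfolding V_def using r_lim by (auto intro!: tendsto_eq_intros)

  have V_step: "r (Suc k) \<le> V k - V (Suc k)"
    if "norm (x k - xbar) < \<delta>" "f k < fbar + \<rho>" for k
  proof -
    have pow: "0 < (f k - fbar) powr \<theta>" "(f k - fbar) powr \<theta> \<le> B * r k"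
      using f_gt[of k] KL that by auto
    have "a * (r (Suc k))\<^sup>2 \<le> f k - f (Suc k)"
      using descent[of k] by simp
    also have "\<dots> \<le> (E k - E (Suc k)) * (f k - fbar) powr \<theta> / (1 - \<theta>)"
      using powr_tangent_bound[of "f (Suc k) - fbar" "f k - fbar" \<theta>] f_gt[of "Suc k"] f_dec[of k] \<theta>
        pow(1)
      by (simp add: E_def powr_minus field_simps)
    also have "\<dots> \<le> (E k - E (Suc k)) * (B * r k) / (1 - \<theta>)"
      using pow(2) \<theta> f_gt[of "Suc k"] f_dec[of k]
      by (intro divide_right_mono mult_left_mono) (auto simp: E_def intro!: powr_mono2)
    finally have "(r (Suc k))\<^sup>2 \<le> r k * (A * (E k - E (Suc k)))"
      using a \<theta> by (simp add: A_def field_simps)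
    \<comment> \<open>AM-GM for \<open>r k\<close> and \<open>A * (E k - E (Suc k))\<close>. After
      the square root the left side is \<open>2 * r (Suc k)\<close>; one copy moves to the right and
      forms \<open>V k - V (Suc k)\<close>.\<close>
    also have "4 * \<dots> \<le> (r k + A * (E k - E (Suc k)))\<^sup>2"
      using zero_le_power2[of "r k - A * (E k - E (Suc k))"] by (simp add: power2_eq_square algebra_simps)
    finally have "(2 * r (Suc k))\<^sup>2 \<le> (r k + A * (E k - E (Suc k)))\<^sup>2"
      by simp
    moreover have "0 \<le> r k + A * (E k - E (Suc k))"
      using A r_pos[of k] \<theta> f_gt[of "Suc k"] f_dec[of k]
      by (intro add_nonneg_nonneg mult_nonneg_nonneg) (auto simp: E_def intro!: powr_mono2)
    ultimately have "2 * r (Suc k) \<le> r k + A * (E k - E (Suc k))"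
      by (rule power2_le_imp_le)
    then show ?thesis
      by (simp add: V_def algebra_simps)
  qed

  \<comment> \<open>Only the subsequence is known to approach \<open>xbar\<close>, so it supplies
    the starting index. The term \<open>V K\<close> reserves room for the whole remaining
    path.\<close>
  obtain K where K: "norm (x K - xbar) + V K < \<delta>" "f K < fbar + \<rho>"
  proof -
    have "(\<lambda>j. norm ((x \<circ> s) j - xbar) + (V \<circ> s) j) \<longlonglongrightarrow> 0"
      using sub(2) LIMSEQ_subseq_LIMSEQ[OF V_lim sub(1)]
      by (intro tendsto_add_zero tendsto_norm_zero LIM_zero)
    then have "\<forall>\<^sub>F j in sequentially. norm ((x \<circ> s) j - xbar) + (V \<circ> s) j < \<delta>"
      using nbhd(1) by (rule order_tendstoD)
    moreover have "\<forall>\<^sub>F j in sequentially. (f \<circ> s) j < fbar + \<rho>"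
      using nbhd(2) by (intro order_tendstoD(2)[OF LIMSEQ_subseq_LIMSEQ[OF f_lim sub(1)]]) auto
    ultimately have "\<forall>\<^sub>F j in sequentially.
        norm ((x \<circ> s) j - xbar) + (V \<circ> s) j < \<delta> \<and> (f \<circ> s) j < fbar + \<rho>"
      by (rule eventually_conj)
    then show ?thesis
      using that by (auto simp: eventually_sequentially)
  qed
  \<comment> \<open>The sum cannot grow: a step leads away from \<open>xbar\<close> by at most
    \<open>r (Suc k)\<close>, and \<open>V\<close> drops by at least as much. The proximity that
    \<open>V_step\<close> asks for comes from the induction hypothesis.\<close>
  have trap: "norm (x k - xbar) + V k < \<delta>" if "K \<le> k" for k
    using that
  proof (induction k rule: dec_induct)
    case base
    show ?case by (rule K(1))
  next
    case (step k)
    have "r (Suc k) \<le> V k - V (Suc k)"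
      using step V_nonneg[of k] f_mono[of K k] K(2) by (intro V_step) auto
    moreover have "norm (x (Suc k) - xbar) \<le> norm (x (Suc k) - x k) + norm (x k - xbar)"
      by norm
    ultimately show ?case
      using step assms(7)[of k] by linarith
  qed
  then have near: "norm (x k - xbar) < \<delta>" "f k < fbar + \<rho>" if "K \<le> k" for k
    using that V_nonneg[of k] f_mono[of K k] K(2) by (fastforce, fastforce)
  have path: "norm (x m - x k) \<le> V k - V m" if "K \<le> k" "k \<le> m" for k m
    using that(2)
  proof (induction m rule: dec_induct)
    case (step m)
    have "r (Suc m) \<le> V m - V (Suc m)"
      using that step by (intro V_step near) auto
    moreover have "norm (x (Suc m) - x k) \<le> norm (x (Suc m) - x m) + norm (x m - x k)"
      by norm
    ultimately show ?case
      using step assms(7)[of m] by linarith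
  qed simp
  \<comment> \<open>Let \<open>m\<close> run to infinity along \<open>s\<close> in
    \<open>path\<close>, dropping the nonnegative \<open>V m\<close>.\<close>
  have V_bound: "norm (x k - xbar) \<le> V k" if "K \<le> k" for k
  proof -
    have "norm (xbar - x k) \<le> V k"
    proof (rule tendsto_upperbound)
      show "(\<lambda>j. norm ((x \<circ> s) j - x k)) \<longlonglongrightarrow> norm (xbar - x k)"
        by (intro tendsto_intros sub)
      show "\<forall>\<^sub>F j in sequentially. norm ((x \<circ> s) j - x k) \<le> V k"
        using eventually_ge_at_top[of k]
      proof eventually_elim
        case (elim j)
        then have "k \<le> s j"
          using seq_suble[OF sub(1), of j] by simp
        then show ?case
          using path[OF that, of "s j"] V_nonneg[of "s j"] by simp
      qed
    qed simp
    then show ?thesis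
      by (simp add: norm_minus_commute)
  qed

  show thesis
  proof (rule that)
    show "r \<longlonglongrightarrow> 0"
      by (rule r_lim)
    have "(\<lambda>k. x k - xbar) \<longlonglongrightarrow> 0"
      using V_bound by (intro Lim_null_comparison[OF _ V_lim]) (auto simp: eventually_sequentially)
    then show "x \<longlonglongrightarrow> xbar"
      by (rule LIM_zero_cancel)
    \<comment> \<open>A second use of KL removes the function values from the rate: its power
      \<open>(1 - \<theta>) / \<theta>\<close> bounds \<open>E k\<close> by a multiple of the same
      power of \<open>r k\<close>. The witness absorbs that factor.\<close>
    show "\<forall>\<^sub>F k in sequentially. norm (x k - xbar)
        \<le> r k + A * B powr ((1 - \<theta>) / \<theta>) * (r k) powr ((1 - \<theta>) / \<theta>)"
      using eventually_ge_at_top[of K]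
    proof eventually_elim
      case (elim k)
      have "E k = ((f k - fbar) powr \<theta>) powr ((1 - \<theta>) / \<theta>)"
        using \<theta> by (simp add: E_def powr_powr)
      also have "\<dots> \<le> (B * r k) powr ((1 - \<theta>) / \<theta>)"
        using \<theta> by (intro powr_mono2 KL near[OF elim] f_gt) auto
      also have "\<dots> = B powr ((1 - \<theta>) / \<theta>) * (r k) powr ((1 - \<theta>) / \<theta>)"
        using B r_pos[of k] by (simp add: powr_mult)
      finally have "A * E k \<le> A * (B powr ((1 - \<theta>) / \<theta>) * (r k) powr ((1 - \<theta>) / \<theta>))"
        using A by (intro mult_left_mono) auto
      then show ?case
        using V_bound[OF elim] by (simp add: V_def mult.assoc)
    qed
  qed
qed

text \<open>Dividing by \<open>(r k) powr \<gamma>\<close> leaves the positive exponents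
  \<open>1 - \<gamma>\<close> and \<open>p - \<gamma>\<close>, so the quotient tends to 0.\<close>

lemma eventually_powr_dominated:
  fixes r :: "nat \<Rightarrow> real"
  assumes r: "r \<longlonglongrightarrow> 0" "\<And>k. 0 < r k" and "0 < C" "\<gamma> < 1" "\<gamma> < p"
  shows "\<forall>\<^sub>F k in sequentially. r k + A * (r k) powr p < C * (r k) powr \<gamma>"
proof -
  have "(\<lambda>k. (r k) powr b) \<longlonglongrightarrow> 0" if "0 < b" for b
    by (intro tendsto_zero_powrI[where b = b]) (use r that in \<open>auto intro!: eventuallyI less_imp_le\<close>)
  then have "(\<lambda>k. (r k) powr (1 - \<gamma>) + A * (r k) powr (p - \<gamma>)) \<longlonglongrightarrow> 0"
    using assms by (intro tendsto_add_zero tendsto_mult_right_zero) auto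
  then have "\<forall>\<^sub>F k in sequentially. (r k) powr (1 - \<gamma>) + A * (r k) powr (p - \<gamma>) < C"
    using \<open>0 < C\<close> by (rule order_tendstoD)
  then show ?thesis
  proof eventually_elim
    case (elim k)
    have "r k + A * (r k) powr p = ((r k) powr (1 - \<gamma>) + A * (r k) powr (p - \<gamma>)) * (r k) powr \<gamma>"
      using r(2)[of k] by (simp add: algebra_simps flip: powr_add)
    also have "\<dots> < C * (r k) powr \<gamma>"
      using elim r(2)[of k] by (intro mult_strict_right_mono) auto
    finally show ?case .
  qed
qed

section \<open>The proximal gradient step\<close>

lemma Prox_finite:
  assumes "proper_fun g" "p \<in> Prox \<alpha> g z"
  shows "\<bar>g p\<bar> \<noteq> \<infinity>"
proof -
  obtain u where u: "g u \<noteq> \<infinity>"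
    using assms by (auto simp: proper_fun_def)
  have "g p + ereal (1 / (2 * \<alpha>) * (norm (p - z))\<^sup>2) \<le> g u + ereal (1 / (2 * \<alpha>) * (norm (u - z))\<^sup>2)"
    using assms(2) by (auto simp: Prox_def)
  moreover have "g p \<noteq> -\<infinity>"
    using assms by (auto simp: proper_fun_def)
  ultimately show ?thesis
    using u by auto
qed

lemma Prox_real_le:
  assumes "proper_fun g" "p \<in> Prox \<alpha> g z" "\<bar>g u\<bar> \<noteq> \<infinity>"
  shows "real_of_ereal (g p) + 1 / (2 * \<alpha>) * (norm (p - z))\<^sup>2
    \<le> real_of_ereal (g u) + 1 / (2 * \<alpha>) * (norm (u - z))\<^sup>2"
proof -
  have "g p + ereal (1 / (2 * \<alpha>) * (norm (p - z))\<^sup>2) \<le> g u + ereal (1 / (2 * \<alpha>) * (norm (u - z))\<^sup>2)"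
    using assms(2) by (auto simp: Prox_def)
  moreover obtain a b where "g p = ereal a" "g u = ereal b"
    using Prox_finite[OF assms(1,2)] assms(3) by (metis ereal_real)
  ultimately show ?thesis
    by simp
qed

text \<open>Completing the square splits the prox penalty into the linear and quadratic terms shown
  and \<open>\<alpha> / 2 * (norm w)\<^sup>2\<close>, which is the same for all points and
  cancels.\<close>

lemma prox_gradient_le:
  assumes "0 < \<alpha>" "proper_fun g" "p \<in> Prox \<alpha> g (y - \<alpha> *\<^sub>R w)" "\<bar>g u\<bar> \<noteq> \<infinity>"
  shows "real_of_ereal (g p) + w \<bullet> (p - y) + (norm (p - y))\<^sup>2 / (2 * \<alpha>)
    \<le> real_of_ereal (g u) + w \<bullet> (u - y) + (norm (u - y))\<^sup>2 / (2 * \<alpha>)"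
proof -
  have expand: "1 / (2 * \<alpha>) * (norm (v - (y - \<alpha> *\<^sub>R w)))\<^sup>2
      = w \<bullet> (v - y) + (norm (v - y))\<^sup>2 / (2 * \<alpha>) + \<alpha> / 2 * (norm w)\<^sup>2" for v
  proof -
    have "(norm (v - (y - \<alpha> *\<^sub>R w)))\<^sup>2 = (norm ((v - y) + \<alpha> *\<^sub>R w))\<^sup>2"
      by (simp add: algebra_simps)
    also have "\<dots> = (norm (v - y))\<^sup>2 + 2 * \<alpha> * (w \<bullet> (v - y)) + \<alpha>\<^sup>2 * (norm w)\<^sup>2"
      unfolding power2_norm_eq_inner
      by (simp add: inner_add_left inner_add_right inner_commute power2_eq_square algebra_simps)
    finally show ?thesis
      using \<open>0 < \<alpha>\<close> by (simp add: field_simps power2_eq_square)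
  qed
  show ?thesis
    using Prox_real_le[OF assms(2-4)] unfolding expand by simp
qed

text \<open>Take the competitor \<open>u = y\<close> in the prox inequality. Replacing the
  linearization of \<open>h\<close> at \<open>y\<close> by \<open>h p\<close> costs
  \<open>L / 2\<close> of the quadratic term \<open>1 / (2 * \<alpha>)\<close>.\<close>

lemma prox_gradient_descent:
  fixes h :: "real^'n \<Rightarrow> real"
  assumes D: "\<And>x. GDERIV h x :> G x" and L: "L-lipschitz_on UNIV G"
    and "0 < \<alpha>" "proper_fun g" "p \<in> Prox \<alpha> g (y - \<alpha> *\<^sub>R G y)" "\<bar>g y\<bar> \<noteq> \<infinity>"
  shows "real_of_ereal (g p) + h p + (1 / \<alpha> - L) / 2 * (norm (p - y))\<^sup>2 \<le> real_of_ereal (g y) + h y"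
proof -
  have "(1 / \<alpha> - L) / 2 * (norm (p - y))\<^sup>2 = (norm (p - y))\<^sup>2 / (2 * \<alpha>) - L / 2 * (norm (p - y))\<^sup>2"
    using \<open>0 < \<alpha>\<close> by (simp add: field_simps)
  then show ?thesis
    using prox_gradient_le[OF assms(3-6)] lipschitz_gradient_upper_bound[OF D L, of p y]
    by (simp only: diff_self inner_zero_right norm_zero power2_eq_square mult_zero_left div_0)
qed

text \<open>Minimality in the prox problem and the quadratic lower bound for \<open>h\<close> at
  \<open>p\<close> give \<open>F\<close> a quadratic minorant that touches it at \<open>p\<close>
  with this slope. The quadratic error disappears in the difference quotient.\<close>

lemma prox_gradient_regular_subdiff:
  fixes h :: "real^'n \<Rightarrow> real"
  assumes D: "\<And>x. GDERIV h x :> G x" and L: "L-lipschitz_on UNIV G"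
    and "0 < \<alpha>" "proper_fun g" "p \<in> Prox \<alpha> g (y - \<alpha> *\<^sub>R G y)"
  shows "G p - G y - (1 / \<alpha>) *\<^sub>R (p - y) \<in> regular_subdiff (\<lambda>z. g z + ereal (h z)) p"
proof -
  define v where "v = G p - G y - (1 / \<alpha>) *\<^sub>R (p - y)"
  \<comment> \<open>The term \<open>1 / (2 * \<alpha>)\<close> comes from the prox penalty,
    \<open>L / 2\<close> from \<open>h\<close>.\<close>
  define K where "K = 1 / (2 * \<alpha>) + L / 2"
  define F where "F z = g z + ereal (h z)" for z
  have gp: "\<bar>g p\<bar> \<noteq> \<infinity>"
    using assms(4,5) by (rule Prox_finite)
  then have Fp: "F p = ereal (real_of_ereal (g p) + h p)"
    by (cases "g p") (auto simp: F_def)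
  have quot: "ereal (- K * norm (u - p)) \<le> (F u - F p - ereal (v \<bullet> (u - p))) / ereal (norm (u - p))"
    if "u \<noteq> p" for u
  proof (cases "g u = \<infinity>")
    case True
    then show ?thesis
      using that by (simp add: F_def Fp)
  next
    case False
    then have gu: "\<bar>g u\<bar> \<noteq> \<infinity>"
      using assms(4) by (auto simp: proper_fun_def)
    have "(norm (u - y))\<^sup>2 = (norm ((u - p) + (p - y)))\<^sup>2"
      by simp
    also have "\<dots> = (norm (u - p))\<^sup>2 + 2 * ((p - y) \<bullet> (u - p)) + (norm (p - y))\<^sup>2"
      unfolding power2_norm_eq_inner
      by (simp only: inner_add_left inner_add_right) (simp add: inner_commute)
    finally have uy: "(norm (u - y))\<^sup>2 / (2 * \<alpha>)
        = (norm (u - p))\<^sup>2 / (2 * \<alpha>) + (p - y) \<bullet> (u - p) / \<alpha> + (norm (p - y))\<^sup>2 / (2 * \<alpha>)"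
      using \<open>0 < \<alpha>\<close> by (simp add: field_simps)
    have "real_of_ereal (g p) - G y \<bullet> (u - p) - (p - y) \<bullet> (u - p) / \<alpha> - (norm (u - p))\<^sup>2 / (2 * \<alpha>)
        \<le> real_of_ereal (g u)"
      using prox_gradient_le[OF assms(3-5) gu] uy by (simp add: inner_diff_right)
    moreover have "h p + G p \<bullet> (u - p) - L / 2 * (norm (u - p))\<^sup>2 \<le> h u"
      using lipschitz_gradient_lower_bound[OF D L, of u p] by simp
    moreover have "v \<bullet> (u - p) = G p \<bullet> (u - p) - G y \<bullet> (u - p) - (p - y) \<bullet> (u - p) / \<alpha>"
      by (simp add: v_def inner_diff_left)
    moreover have "- K * norm (u - p) * norm (u - p)
        = - ((norm (u - p))\<^sup>2 / (2 * \<alpha>)) - L / 2 * (norm (u - p))\<^sup>2"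
      by (simp add: K_def power2_eq_square algebra_simps)
    ultimately have "- K * norm (u - p) * norm (u - p)
        \<le> real_of_ereal (g u) + h u - (real_of_ereal (g p) + h p) - v \<bullet> (u - p)"
      by linarith
    then have "- K * norm (u - p)
        \<le> (real_of_ereal (g u) + h u - (real_of_ereal (g p) + h p) - v \<bullet> (u - p)) / norm (u - p)"
      using that by (simp add: pos_le_divide_eq)
    moreover have "F u = ereal (real_of_ereal (g u) + h u)"
      using gu by (cases "g u") (auto simp: F_def)
    ultimately show ?thesis
      using that by (simp add: Fp)
  qed
  have "((\<lambda>u. ereal (- K * norm (u - p))) \<longlongrightarrow> ereal 0) (at p)"
    by (auto intro!: tendsto_eq_intros)
  then have "ereal 0 = Liminf (at p) (\<lambda>u. ereal (- K * norm (u - p)))"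
    by (intro lim_imp_Liminf[symmetric]) auto
  also have "\<dots> \<le> Liminf (at p) (\<lambda>u. (F u - F p - ereal (v \<bullet> (u - p))) / ereal (norm (u - p)))"
    by (rule Liminf_mono) (use quot in \<open>auto simp: eventually_at_filter\<close>)
  finally show ?thesis
    using Fp by (simp add: regular_subdiff_def zero_ereal_def flip: v_def F_def)
qed

section \<open>Limiting subgradients and the KL inequality over the reals\<close>

lemma regular_subdiff_subset_limiting: "regular_subdiff F x \<subseteq> limiting_subdiff F x"
proof
  fix v assume v: "v \<in> regular_subdiff F x"
  then have "\<bar>F x\<bar> \<noteq> \<infinity>"
    by (simp add: regular_subdiff_def)
  then show "v \<in> limiting_subdiff F x"
    unfolding limiting_subdiff_def using v
    by (intro CollectI conjI exI[where x = "\<lambda>_. x"] exI[where x = "\<lambda>_. v"]) auto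
qed

text \<open>The desingularizing function has derivative
  \<open>(1 - \<theta>) / \<mu> * s powr - \<theta>\<close>, and \<open>dist_subdiff\<close> is at
  most the norm of any single subgradient. Multiplying by \<open>s powr \<theta>\<close> gives the
  claim.\<close>

lemma KL_exponent_real:
  assumes KL: "KL_exponent \<theta> F xh" and \<theta>: "\<theta> < 1" and fin: "\<bar>F xh\<bar> \<noteq> \<infinity>"
  obtains \<delta> \<rho> C :: real where "0 < \<delta>" "0 < \<rho>" "0 < C"
    "\<And>x v. norm (x - xh) < \<delta> \<Longrightarrow> v \<in> limiting_subdiff F x \<Longrightarrow>
      real_of_ereal (F xh) < real_of_ereal (F x) \<Longrightarrow>
      real_of_ereal (F x) < real_of_ereal (F xh) + \<rho> \<Longrightarrow>
      (real_of_ereal (F x) - real_of_ereal (F xh)) powr \<theta> \<le> C * norm v"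
proof -
  obtain \<mu> where \<mu>: "0 < \<mu>" and KL': "KL_with (\<lambda>s. inverse \<mu> * s powr (1 - \<theta>)) F xh"
    using KL by (auto simp: KL_exponent_def)
  obtain \<eta> U where \<eta>: "0 < \<eta>" and U: "open U" "xh \<in> U"
    and ineq: "\<And>x. x \<in> U \<Longrightarrow> F xh < F x \<Longrightarrow> F x < F xh + \<eta> \<Longrightarrow>
        1 \<le> ereal (deriv (\<lambda>s. inverse \<mu> * s powr (1 - \<theta>)) (real_of_ereal (F x - F xh)))
          * dist_subdiff F x"
    using KL' by (auto simp: KL_with_def)
  obtain \<delta> where \<delta>: "0 < \<delta>" "ball xh \<delta> \<subseteq> U"
    using U openE by blast
  \<comment> \<open>\<open>\<eta>\<close> may be infinite; then any positive real will do.\<close>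
  obtain \<rho> where \<rho>: "0 < \<rho>" "ereal \<rho> \<le> \<eta>"
  proof (cases \<eta>)
    case (real e)
    then show ?thesis
      using \<eta> that[of e] by simp
  next
    case PInf
    then show ?thesis
      using that[of 1] by simp
  next
    case MInf
    then show ?thesis
      using \<eta> by simp
  qed
  define C where "C = inverse \<mu> * (1 - \<theta>)"
  have C: "0 < C"
    using \<mu> \<theta> by (simp add: C_def)
  show thesis
  proof (rule that[OF \<delta>(1) \<rho>(1) C])
    fix x v
    assume x: "norm (x - xh) < \<delta>" and v: "v \<in> limiting_subdiff F x"
      and lower: "real_of_ereal (F xh) < real_of_ereal (F x)"
      and upper: "real_of_ereal (F x) < real_of_ereal (F xh) + \<rho>"
    define s where "s = real_of_ereal (F x) - real_of_ereal (F xh)"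
    have s: "0 < s"
      using lower by (simp add: s_def)
    obtain a b where ab: "F x = ereal a" "F xh = ereal b"
      using fin v by (cases "F x"; cases "F xh") (auto simp: limiting_subdiff_def)
    have "F x < F xh + ereal \<rho>"
      using upper ab by simp
    also have "\<dots> \<le> F xh + \<eta>"
      using \<rho>(2) by (rule add_left_mono)
    finally have "1 \<le> ereal (deriv (\<lambda>s. inverse \<mu> * s powr (1 - \<theta>)) s) * dist_subdiff F x"
      using ineq[of x] lower x \<delta>(2) ab by (auto simp: s_def subset_iff dist_norm norm_minus_commute)
    also have "deriv (\<lambda>s. inverse \<mu> * s powr (1 - \<theta>)) s = C * s powr - \<theta>"
      unfolding C_def using s \<mu>
      by (intro DERIV_imp_deriv) (auto intro!: derivative_eq_intros simp: field_simps)
    also have "ereal (C * s powr - \<theta>) * dist_subdiff F x \<le> ereal (C * s powr - \<theta>) * ereal (norm v)"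
      using C v unfolding dist_subdiff_def by (intro ereal_mult_left_mono INF_lower2[of v]) auto
    finally have "1 \<le> C * s powr - \<theta> * norm v"
      by (simp add: one_ereal_def)
    then show "s powr \<theta> \<le> C * norm v"
      using s by (simp add: powr_minus field_simps)
  qed
qed

section \<open>Application to SCN-PG: convergence and identification of the support\<close>

theorem theorem5:
  fixes g F :: "real^'n \<Rightarrow> ereal" and h :: "real^'n \<Rightarrow> real"
    and L \<alpha> c \<eta> q \<omega>_low C\<^sub>3 \<gamma> \<theta> :: real
    and \<omega> \<epsilon> M \<sigma> :: "nat \<Rightarrow> real"
    and x y :: "nat \<Rightarrow> real^'n"
  assumes F_def: "F = (\<lambda>z. g z + ereal (h z))"
    and g: "proper_fun g" "lsc g"
    and h: "C2 h" "0 \<le> L" "L-lipschitz_on UNIV (gradient h)"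
    and a: "\<And>z S. S \<subseteq> supp z \<Longrightarrow> hess_strictly_continuous_rel (same_supp z) F S z"
    and b: "(INF z. F z) > -\<infinity>"
    and c: "coercive F"
    and d: "0 < \<theta>" "\<theta> < 1" "\<And>z. z \<in> dom_subdiff F \<Longrightarrow> KL_exponent \<theta> F z"
    and params: "0 < \<alpha>" "ereal \<alpha> < 1 / ereal L" "0 < c" "0 < \<eta>" "0 < q" "q < 1"
    and \<omega>: "1 < \<omega>_low" "\<And>k. k \<ge> 1 \<Longrightarrow> \<omega>_low \<le> \<omega> k"
    and \<gamma>: "0 < \<gamma>" "\<gamma> < min 1 ((1 - \<theta>) / \<theta>)" and C\<^sub>3: "0 < C\<^sub>3"
    and start: "x 0 = y 0"
    and \<epsilon>: "\<And>k. k \<ge> 1 \<Longrightarrow>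
          \<epsilon> k = C\<^sub>3 * (norm (x k - y (k - 1)) + norm (x (k - 1) - y (k - 1))) powr \<gamma>"
    and \<epsilon>_pos: "\<And>k. k \<ge> 1 \<Longrightarrow> 0 < \<epsilon> k"
    and alg: "SCN_PG g h \<alpha> c \<eta> q \<omega> \<epsilon> M \<sigma> x y"
  shows "\<exists>xbar. x \<longlonglongrightarrow> xbar \<and> (\<forall>\<^sub>F k in sequentially. active (\<epsilon> k) (x k) = supp xbar)"
proof -
  define Fr where "Fr z = real_of_ereal (F z)" for z
  \<comment> \<open>Nothing forces \<open>g (x 0)\<close> to be finite, whereas each
    \<open>p k\<close> is a prox point and has a finite value.\<close>
  define p where "p k = x (Suc k)" for k
  define r where "r k = norm (x (Suc k) - y k) + norm (x k - y k)" for k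
  \<comment> \<open>The outer half pays for
    \<open>(s + t)\<^sup>2 \<le> 2 * s\<^sup>2 + 2 * t\<^sup>2\<close> when the decreases of the two
    substeps are merged.\<close>
  define a where "a = min ((1 / \<alpha> - L) / 2) (\<eta> / 4) / 2"
  define B where "B = L + 1 / \<alpha>"
  define v where "v k = gradient h (p k) - gradient h (y k) - (1 / \<alpha>) *\<^sub>R (p k - y k)" for k

  have grad: "GDERIV h z :> gradient h z" for z
    using h(1) by (intro GDERIV_gradient) (auto simp: C2_def twice_differentiable_at_def dest: eventually_nhds_x_imp_x)
  have F_finite_iff: "\<bar>F z\<bar> \<noteq> \<infinity> \<longleftrightarrow> \<bar>g z\<bar> \<noteq> \<infinity>" for z
    by (cases "g z") (auto simp: F_def)
  have Fr_eq: "Fr z = real_of_ereal (g z) + h z" if "\<bar>g z\<bar> \<noteq> \<infinity>" for z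
    using that by (cases "g z") (auto simp: F_def Fr_def)
  have F_eq: "F z = ereal (Fr z)" if "\<bar>g z\<bar> \<noteq> \<infinity>" for z
    using that F_finite_iff[of z] by (simp add: Fr_def ereal_real)

  have "L < 1 / \<alpha>"
  proof (cases "L = 0")
    case False
    then have "\<alpha> < 1 / L"
      using params(2) h(2) by (simp add: one_ereal_def)
    then show ?thesis
      using False h(2) params(1) by (simp add: field_simps)
  qed (use params(1) in simp)
  then have a_pos: "0 < a"
    using params by (simp add: a_def)
  have B_pos: "0 < B"
    using params(1) h(2) by (simp add: B_def add_nonneg_pos)

  have prox: "p k \<in> Prox \<alpha> g (y k - \<alpha> *\<^sub>R gradient h (y k))" for k
    using alg[unfolded SCN_PG_def Let_def, rule_format, of "Suc k"] by (simp add: p_def)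
  have p_fin: "\<bar>g (p k)\<bar> \<noteq> \<infinity>" for k
    using g(1) prox by (rule Prox_finite)
  \<comment> \<open>If the active set is empty, the two points coincide and the inequality is
    trivial; otherwise it is the acceptance test of the line search.\<close>
  have decrease: "sufficient_decrease F c \<eta> (p k) (y (Suc k))" for k
    using alg[unfolded SCN_PG_def Let_def, rule_format, of "Suc k"]
    by (auto simp: sufficient_decrease_def linesearch_step_def F_def p_def split: if_splits)
  have y_fin: "\<bar>g (y (Suc k))\<bar> \<noteq> \<infinity>"
    and y_le: "Fr (y (Suc k)) \<le> Fr (p k) - \<eta> / 4 * (norm (y (Suc k) - p k))\<^sup>2" for k
  proof -
    have le: "F (y (Suc k)) \<le> ereal (Fr (p k) - \<eta> / 4 * (norm (y (Suc k) - p k))\<^sup>2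
        - c / 6 * norm (y (Suc k) - p k) ^ 3)"
      using decrease[of k] p_fin[of k] by (simp add: sufficient_decrease_def F_eq)
    then have "F (y (Suc k)) \<noteq> \<infinity>"
      by auto
    then have "g (y (Suc k)) \<noteq> \<infinity>"
      by (auto simp: F_def)
    then show fin: "\<bar>g (y (Suc k))\<bar> \<noteq> \<infinity>"
      using g(1) by (auto simp: proper_fun_def)
    have "0 \<le> c / 6 * norm (y (Suc k) - p k) ^ 3"
      using params(3) by simp
    then show "Fr (y (Suc k)) \<le> Fr (p k) - \<eta> / 4 * (norm (y (Suc k) - p k))\<^sup>2"
      using le F_eq[OF fin] by simp
  qed

  \<comment> \<open>Since \<open>0 powr \<gamma> = 0\<close>, a vanishing \<open>r k\<close> would
    make the threshold \<open>\<epsilon> (Suc k)\<close> zero.\<close>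
  have r_pos: "0 < r k" for k
  proof -
    have "r k \<noteq> 0"
      using \<epsilon>[of "Suc k"] \<epsilon>_pos[of "Suc k"] by (auto simp: r_def)
    moreover have "0 \<le> r k"
      by (simp add: r_def)
    ultimately show ?thesis
      by simp
  qed
  \<comment> \<open>Stated from \<open>Suc k\<close> on because \<open>g (y 0)\<close> may be
    infinite.\<close>
  have descent: "Fr (p (Suc k)) + a * (r (Suc k))\<^sup>2 \<le> Fr (p k)" for k
  proof -
    define s t where "s = norm (p (Suc k) - y (Suc k))" and "t = norm (y (Suc k) - p k)"
    have "Fr (p (Suc k)) + (1 / \<alpha> - L) / 2 * s\<^sup>2 \<le> Fr (y (Suc k))"
      using prox_gradient_descent[OF grad h(3) params(1) g(1) prox y_fin] p_fin y_fin
      by (simp add: Fr_eq s_def)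
    moreover have "Fr (y (Suc k)) + \<eta> / 4 * t\<^sup>2 \<le> Fr (p k)"
      using y_le[of k] by (simp add: t_def)
    moreover have "a * (r (Suc k))\<^sup>2 \<le> (1 / \<alpha> - L) / 2 * s\<^sup>2 + \<eta> / 4 * t\<^sup>2"
    proof -
      have "r (Suc k) = s + t"
        by (simp add: r_def s_def t_def p_def norm_minus_commute)
      moreover have "(s + t)\<^sup>2 \<le> 2 * s\<^sup>2 + 2 * t\<^sup>2"
        using zero_le_power2[of "s - t"] by (simp add: power2_eq_square algebra_simps)
      ultimately have "a * (r (Suc k))\<^sup>2 \<le> 2 * a * s\<^sup>2 + 2 * a * t\<^sup>2"
        using a_pos mult_left_mono[of "(s + t)\<^sup>2" "2 * s\<^sup>2 + 2 * t\<^sup>2" a] by (simp add: algebra_simps)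
      also have "\<dots> \<le> (1 / \<alpha> - L) / 2 * s\<^sup>2 + \<eta> / 4 * t\<^sup>2"
        by (intro add_mono mult_right_mono) (auto simp: a_def min_def)
      finally show ?thesis .
    qed
    ultimately show ?thesis
      by linarith
  qed
  have step: "norm (p (Suc k) - p k) \<le> r (Suc k)" for k
    unfolding r_def p_def by norm

  have v: "v k \<in> regular_subdiff F (p k)" for k
    unfolding F_def v_def by (rule prox_gradient_regular_subdiff[OF grad h(3) params(1) g(1) prox])
  have v_norm: "norm (v k) \<le> B * r k" for k
  proof -
    have "norm (v k) \<le> norm (gradient h (p k) - gradient h (y k)) + norm ((1 / \<alpha>) *\<^sub>R (p k - y k))"
      unfolding v_def by (rule norm_triangle_ineq4)
    also have "\<dots> \<le> L * norm (p k - y k) + 1 / \<alpha> * norm (p k - y k)"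
      using lipschitz_onD[OF h(3), of "p k" "y k"] params(1) by (simp add: dist_norm)
    also have "\<dots> \<le> B * r k"
      using B_pos mult_left_mono[of "norm (p k - y k)" "r k" B]
      by (simp add: B_def r_def p_def algebra_simps)
    finally show ?thesis .
  qed

  have dec: "decseq (\<lambda>k. Fr (p k))"
  proof (rule decseq_SucI)
    show "Fr (p (Suc k)) \<le> Fr (p k)" for k
      using descent[of k] a_pos by (smt (verit) mult_nonneg_nonneg zero_le_power2)
  qed
  obtain l where l: "(\<lambda>k. Fr (p k)) \<longlonglongrightarrow> l"
  proof -
    obtain m where m: "(INF z. F z) > ereal m"
      using ereal_dense2[OF b] by blast
    have "m \<le> Fr (p k)" for k
    proof -
      have "ereal m < F (p k)"
        using m by (rule less_INF_D) simp
      then show ?thesis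
        using F_eq[OF p_fin] by simp
    qed
    then show ?thesis
      using decseq_convergent[OF dec] that by blast
  qed
  \<comment> \<open>Descent keeps all iterates in one sublevel set, which is bounded by
    coercivity.\<close>
  have "bounded (range p)"
  proof -
    have "\<forall>\<^sub>F z in at_infinity. ereal (Fr (p 0)) < F z"
      using c by (simp add: coercive_def tendsto_PInfty)
    then obtain R where R: "\<And>z. R \<le> norm z \<Longrightarrow> ereal (Fr (p 0)) < F z"
      by (auto simp: eventually_at_infinity)
    have "norm (p k) \<le> R" for k
      using R[of "p k"] decseqD[OF dec, of 0 k] F_eq[OF p_fin[of k]] by force
    then show ?thesis
      by (auto simp: bounded_iff)
  qed
  then obtain s xbar where s: "strict_mono s" "(p \<circ> s) \<longlonglongrightarrow> xbar"
    using bounded_imp_convergent_subsequence by blast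

  have r_lim: "r \<longlonglongrightarrow> 0"
    using a_pos descent l by (rule descent_imp_steps_tendsto_0)

  have p_s: "(\<lambda>j. p (s j)) \<longlonglongrightarrow> xbar"
    using s(2) by (simp add: o_def)
  have r_s: "(\<lambda>j. r (s j)) \<longlonglongrightarrow> 0"
    using LIMSEQ_subseq_LIMSEQ[OF r_lim s(1)] by (simp add: o_def)
  have l_s: "(\<lambda>j. Fr (p (s j))) \<longlonglongrightarrow> l"
    using LIMSEQ_subseq_LIMSEQ[OF l s(1)] by (simp add: o_def)
  have y_s: "(\<lambda>j. y (s j)) \<longlonglongrightarrow> xbar"
  proof -
    have "(\<lambda>j. p (s j) - y (s j)) \<longlonglongrightarrow> 0"
      by (rule Lim_null_comparison[OF eventuallyI r_s]) (simp add: r_def p_def)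
    from tendsto_diff[OF p_s this] show ?thesis
      by simp
  qed
  have h_s: "(\<lambda>j. h (p (s j))) \<longlonglongrightarrow> h xbar"
    using grad[of xbar] p_s unfolding gderiv_def
    by (intro isCont_tendsto_compose[of _ h] has_derivative_continuous)
  have grad_s: "(\<lambda>j. gradient h (y (s j))) \<longlonglongrightarrow> gradient h xbar"
    using lipschitz_on_continuous_on[OF h(3)] y_s
    by (intro isCont_tendsto_compose[of _ "gradient h"]) (simp_all add: continuous_on_eq_continuous_at)
  have g_s: "(\<lambda>j. real_of_ereal (g (p (s j)))) \<longlonglongrightarrow> l - h xbar"
    using tendsto_diff[OF l_s h_s] by (simp add: Fr_eq[OF p_fin])

  \<comment> \<open>Lower semicontinuity gives one half of the convergence of values along the
    subsequence.\<close>
  have "g xbar \<le> ereal (l - h xbar)"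
  proof (rule dense_le)
    fix e assume e: "e < g xbar"
    have "\<forall>\<^sub>F u in at xbar. e < g u"
      using g(2) e by (auto simp: lsc_def le_Liminf_iff)
    \<comment> \<open>\<open>lsc\<close> speaks of punctured neighbourhoods, but
      \<open>p (s j)\<close> may equal \<open>xbar\<close>; the choice of \<open>e\<close> covers
      the centre.\<close>
    then have "\<forall>\<^sub>F u in nhds xbar. e < g u"
      using e by (auto simp: eventually_at_filter elim: eventually_mono)
    then have "\<forall>\<^sub>F j in sequentially. e < g (p (s j))"
      using p_s by (rule eventually_compose_filterlim)
    then have "\<forall>\<^sub>F j in sequentially. e \<le> ereal (real_of_ereal (g (p (s j))))"
      using p_fin by (auto simp: ereal_real elim: eventually_mono)
    moreover have "(\<lambda>j. ereal (real_of_ereal (g (p (s j))))) \<longlonglongrightarrow> ereal (l - h xbar)"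
      using g_s by simp
    ultimately show "e \<le> ereal (l - h xbar)"
      by (intro tendsto_lowerbound) auto
  qed
  moreover have "g xbar \<noteq> -\<infinity>"
    using g(1) by (auto simp: proper_fun_def)
  ultimately have xbar_fin: "\<bar>g xbar\<bar> \<noteq> \<infinity>" and lower: "real_of_ereal (g xbar) \<le> l - h xbar"
    by (cases "g xbar"; simp)+
  \<comment> \<open>The other half: \<open>g\<close> may be discontinuous, so the prox inequality
    with competitor \<open>xbar\<close> is passed to the limit. The zero terms are kept in the shape
    that the limit rules produce.\<close>
  have "l - h xbar + gradient h xbar \<bullet> (xbar - xbar) + (norm (xbar - xbar))\<^sup>2 / (2 * \<alpha>)
      \<le> real_of_ereal (g xbar) + gradient h xbar \<bullet> (xbar - xbar) + (norm (xbar - xbar))\<^sup>2 / (2 * \<alpha>)"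
  proof (rule LIMSEQ_le)
    show "(\<lambda>j. real_of_ereal (g (p (s j))) + gradient h (y (s j)) \<bullet> (p (s j) - y (s j))
          + (norm (p (s j) - y (s j)))\<^sup>2 / (2 * \<alpha>))
        \<longlonglongrightarrow> l - h xbar + gradient h xbar \<bullet> (xbar - xbar) + (norm (xbar - xbar))\<^sup>2 / (2 * \<alpha>)"
      by (intro tendsto_intros g_s grad_s p_s y_s) (use params(1) in simp)
    show "(\<lambda>j. real_of_ereal (g xbar) + gradient h (y (s j)) \<bullet> (xbar - y (s j))
          + (norm (xbar - y (s j)))\<^sup>2 / (2 * \<alpha>))
        \<longlonglongrightarrow> real_of_ereal (g xbar) + gradient h xbar \<bullet> (xbar - xbar)
          + (norm (xbar - xbar))\<^sup>2 / (2 * \<alpha>)"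
      by (intro tendsto_intros grad_s y_s) (use params(1) in simp)
  qed (use prox_gradient_le[OF params(1) g(1) prox xbar_fin] in blast)
  with lower have l_eq: "l = Fr xbar"
    using Fr_eq[OF xbar_fin] by simp

  \<comment> \<open>Points, values and subgradients all converge along the subsequence, so
    \<open>xbar\<close> is critical and the KL hypothesis applies there.\<close>
  have "0 \<in> limiting_subdiff F xbar"
  proof -
    have "(\<lambda>j. v (s j)) \<longlonglongrightarrow> 0"
    proof (rule Lim_null_comparison[OF eventuallyI])
      show "norm (v (s j)) \<le> B * r (s j)" for j
        by (rule v_norm)
      show "(\<lambda>j. B * r (s j)) \<longlonglongrightarrow> 0"
        using r_s by (rule tendsto_mult_right_zero)
    qed
    moreover have "(\<lambda>j. F (p (s j))) \<longlonglongrightarrow> F xbar"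
      using l_s by (simp add: F_eq[OF p_fin] F_eq[OF xbar_fin] l_eq)
    ultimately show ?thesis
      using p_s v xbar_fin unfolding limiting_subdiff_def F_finite_iff[symmetric]
      by (intro CollectI conjI exI[where x = "\<lambda>j. p (s j)"] exI[where x = "\<lambda>j. v (s j)"]) auto
  qed
  then have "xbar \<in> dom_subdiff F"
    by (auto simp: dom_subdiff_def)
  moreover have "\<bar>F xbar\<bar> \<noteq> \<infinity>"
    using xbar_fin by (simp add: F_finite_iff)
  ultimately obtain \<delta> \<rho> C where nbhd: "0 < \<delta>" "0 < \<rho>" and C: "0 < C"
    and KL: "\<And>z w. norm (z - xbar) < \<delta> \<Longrightarrow> w \<in> limiting_subdiff F z \<Longrightarrow>
        Fr xbar < Fr z \<Longrightarrow> Fr z < Fr xbar + \<rho> \<Longrightarrow> (Fr z - Fr xbar) powr \<theta> \<le> C * norm w"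
    using KL_exponent_real[OF d(3) d(2)] unfolding Fr_def by metis
  have KL_p: "(Fr (p k) - l) powr \<theta> \<le> C * B * r k"
    if "norm (p k - xbar) < \<delta>" "l < Fr (p k)" "Fr (p k) < l + \<rho>" for k
  proof -
    have "(Fr (p k) - l) powr \<theta> \<le> C * norm (v k)"
      using KL[of "p k" "v k"] that v[of k] regular_subdiff_subset_limiting[of F "p k"] l_eq by auto
    also have "\<dots> \<le> C * (B * r k)"
      using C v_norm by (intro mult_left_mono) auto
    finally show ?thesis
      by (simp add: mult.assoc)
  qed
  obtain A where p_lim: "p \<longlonglongrightarrow> xbar" and rate: "\<forall>\<^sub>F k in sequentially.
      norm (p k - xbar) \<le> r k + A * (r k) powr ((1 - \<theta>) / \<theta>)"
    using KL_descent_convergence[OF d(1,2) a_pos mult_pos_pos[OF C B_pos] r_pos descent step l s nbhd KL_p]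
    by blast

  have \<epsilon>_eq: "\<epsilon> (Suc k) = C\<^sub>3 * (r k) powr \<gamma>" for k
    using \<epsilon>[of "Suc k"] by (simp add: r_def)
  \<comment> \<open>Here the bound on \<open>\<gamma>\<close> enters: the exponent of the threshold
    lies below both exponents of the rate.\<close>
  have small: "\<forall>\<^sub>F k in sequentially. norm (p k - xbar) < \<epsilon> (Suc k)"
    using rate eventually_powr_dominated[OF r_lim r_pos C\<^sub>3, of \<gamma> "(1 - \<theta>) / \<theta>" A] \<gamma>(2)
    by (auto simp: \<epsilon>_eq elim: eventually_elim2)
  have \<epsilon>_lim: "(\<lambda>k. \<epsilon> (Suc k)) \<longlonglongrightarrow> 0"
    unfolding \<epsilon>_eq using \<gamma>(1) r_lim r_pos
    by (intro tendsto_mult_right_zero tendsto_zero_powrI[where b = \<gamma>])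
      (auto intro!: eventuallyI less_imp_le)
  \<comment> \<open>Each coordinate in the support has a nonzero limit while the threshold tends to
    0; finiteness of the support makes this uniform.\<close>
  have large: "\<forall>\<^sub>F k in sequentially. \<forall>i\<in>supp xbar. \<epsilon> (Suc k) < \<bar>p k $ i\<bar>"
  proof (rule eventually_ball_finite)
    show "\<forall>i\<in>supp xbar. \<forall>\<^sub>F k in sequentially. \<epsilon> (Suc k) < \<bar>p k $ i\<bar>"
    proof
      fix i assume "i \<in> supp xbar"
      then have "0 < \<bar>xbar $ i\<bar>"
        by (simp add: supp_def)
      moreover have "(\<lambda>k. \<bar>p k $ i\<bar> - \<epsilon> (Suc k)) \<longlonglongrightarrow> \<bar>xbar $ i\<bar> - 0"
        by (intro tendsto_intros p_lim \<epsilon>_lim)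
      ultimately have "\<forall>\<^sub>F k in sequentially. 0 < \<bar>p k $ i\<bar> - \<epsilon> (Suc k)"
        by (intro order_tendstoD) auto
      then show "\<forall>\<^sub>F k in sequentially. \<epsilon> (Suc k) < \<bar>p k $ i\<bar>"
        by simp
    qed
  qed simp
  have "\<forall>\<^sub>F k in sequentially. active (\<epsilon> (Suc k)) (x (Suc k)) = supp xbar"
    using small large
  proof eventually_elim
    case (elim k)
    \<comment> \<open>Off the support, \<open>p k $ i\<close> is also a coordinate of
      \<open>p k - xbar\<close>, so the error bound applies to it.\<close>
    have "\<bar>p k $ i\<bar> < \<epsilon> (Suc k)" if "i \<notin> supp xbar" for i
      using component_le_norm_cart[of "p k - xbar" i] elim that by (simp add: supp_def)
    then show ?case
      using elim by (force simp: active_def p_def)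
  qed
  then have "\<forall>\<^sub>F k in sequentially. active (\<epsilon> k) (x k) = supp xbar"
    by (rule eventually_sequentially_Suc[THEN iffD1])
  moreover have "x \<longlonglongrightarrow> xbar"
    using p_lim unfolding p_def by (rule LIMSEQ_imp_Suc)
  ultimately show ?thesis
    by blast
qed

end
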